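(* There exists a finite structure (with finite signature) that has bounded relational width but does not have relational width $(2,3)$.
   Context: Structures may contain operations and relations; homomorphisms commute with operations and preserve relations. $\mathrm{graph}(\mathcal A)$ is the relational structure on the same domain with the relations of $\mathcal A$ plus, for each $k$-ary operation $f$, the relation $\{(a_1,\dots,a_k,f(a_1,\dots,a_k))\}$. Let $X,A$ be sets and $k$ an integer. Let $\mathcal P=(P_K)$, indexed by subsets $K\subseteq X$ with $|K|\le k$, with $P_K\subseteq A^K$. For $L\subseteq X$ and $C\subseteq A^L$, $\mathcal P$ has the $k$-forth property for $C$ if for every $K\subseteq L$ with $|K|\le k$ and every $f\in P_K$ there is $g\in C$ with $g|_K=f$ and $g|_{K'}\in P_{K'}$ for every $K'\subseteq L$ with $|K'|\le k$. For $l\ge k$, $\mathcal P$ is a $(k,l)$-system from $X$ to $A$ if it has the $k$-forth property for $A^L$ for every $L\subseteq X$ with $|L|\le l$; it is non-trivial if no $P_K$ is empty. For structures $\mathcal X,\mathcal A$ of the same signature, a $(k,l)$-system from $X$ to $A$ is compatible with $\mathcal X$ if it additionally has the $k$-forth property for $\{g:L\to A\mid (g(y_1),\dots,g(y_n))\in R^{\mathrm{graph}(\mathcal A)}\}$ for every relation symbol $R$ of the graph signature and every $(y_1,\dots,y_n)\in R^{\mathrm{graph}(\mathcal X)}$, where $L=\{y_1,\dots,y_n\}$. $\mathcal A$ has relational width $(k,l)$ if every finite structure $\mathcal X$ of the same signature having a non-trivial compatible $(k,l)$-system admits a homomorphism to $\mathcal A$. $\mathcal A$ has bounded relational width if it has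 relational width $(k,l)$ for some $1\le k\le l$. *)

theory Defs
  imports "HOL-Library.FuncSet"
begin

record ('f, 'r) signature =
  ops :: "'f set"
  rels :: "'r set"
  op_arity :: "'f \<Rightarrow> nat"
  rel_arity :: "'r \<Rightarrow> nat"

text \<open>Tuples are lists; an operation is only meaningful on lists over the domain of the
  right length.  Nullary symbols and empty domains are allowed.\<close>

record ('f, 'r, 'a) struct =
  univ :: "'a set"
  op_of :: "'f \<Rightarrow> 'a list \<Rightarrow> 'a"
  rel_of :: "'r \<Rightarrow> 'a list set"

definition tuples :: "'a set \<Rightarrow> nat \<Rightarrow> 'a list set" where
  "tuples A n = {xs. set xs \<subseteq> A \<and> length xs = n}"

definition finite_signature :: "('f, 'r) signature \<Rightarrow> bool" where
  "finite_signature S \<longleftrightarrow> finite (ops S) \<and> finite (rels S)"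

definition is_structure :: "('f, 'r) signature \<Rightarrow> ('f, 'r, 'a) struct \<Rightarrow> bool" where
  "is_structure S A \<longleftrightarrow>
     (\<forall>f\<in>ops S. \<forall>xs\<in>tuples (univ A) (op_arity S f). op_of A f xs \<in> univ A) \<and>
     (\<forall>r\<in>rels S. rel_of A r \<subseteq> tuples (univ A) (rel_arity S r))"

definition homomorphism ::
  "('f, 'r) signature \<Rightarrow> ('f, 'r, 'x) struct \<Rightarrow> ('f, 'r, 'a) struct \<Rightarrow> ('x \<Rightarrow> 'a) \<Rightarrow> bool" where
  "homomorphism S X A h \<longleftrightarrow>
     h ` univ X \<subseteq> univ A \<and>
     (\<forall>f\<in>ops S. \<forall>xs\<in>tuples (univ X) (op_arity S f). h (op_of X f xs) = op_of A f (map h xs)) \<and>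
     (\<forall>r\<in>rels S. \<forall>xs\<in>rel_of X r. map h xs \<in> rel_of A r)"

definition graph_signature :: "('f, 'r) signature \<Rightarrow> ('f, 'r + 'f) signature" where
  "graph_signature S =
     \<lparr>ops = {}, rels = Inl ` rels S \<union> Inr ` ops S, op_arity = op_arity S,
      rel_arity = case_sum (rel_arity S) (\<lambda>f. Suc (op_arity S f))\<rparr>"

definition graph_struct ::
  "('f, 'r) signature \<Rightarrow> ('f, 'r, 'a) struct \<Rightarrow> ('f, 'r + 'f, 'a) struct" where
  "graph_struct S A =
     \<lparr>univ = univ A, op_of = op_of A,
      rel_of = case_sum (rel_of A)
        (\<lambda>f. {xs @ [op_of A f xs] |xs. xs \<in> tuples (univ A) (op_arity S f)})\<rparr>"

definition subsets_le :: "nat \<Rightarrow> 'x set \<Rightarrow> 'x set set" where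
  "subsets_le k X = {K. K \<subseteq> X \<and> finite K \<and> card K \<le> k}"

text \<open>The set \<open>A\<^sup>K\<close> of functions from \<open>K\<close> to \<open>A\<close> is the extensional function space
  \<open>K \<rightarrow>\<^sub>E A\<close>.\<close>

definition forth_property ::
  "nat \<Rightarrow> ('x set \<Rightarrow> ('x \<Rightarrow> 'a) set) \<Rightarrow> 'x set \<Rightarrow> ('x \<Rightarrow> 'a) set \<Rightarrow> bool" where
  "forth_property k P L C \<longleftrightarrow>
     (\<forall>K\<in>subsets_le k L. \<forall>f\<in>P K. \<exists>g\<in>C.
        restrict g K = f \<and> (\<forall>K'\<in>subsets_le k L. restrict g K' \<in> P K'))"

definition kl_system ::
  "nat \<Rightarrow> nat \<Rightarrow> 'x set \<Rightarrow> 'a set \<Rightarrow> ('x set \<Rightarrow> ('x \<Rightarrow> 'a) set) \<Rightarrow> bool" where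
  "kl_system k l X A P \<longleftrightarrow>
     k \<le> l \<and>
     (\<forall>K\<in>subsets_le k X. P K \<subseteq> (K \<rightarrow>\<^sub>E A)) \<and>
     (\<forall>L\<in>subsets_le l X. forth_property k P L (L \<rightarrow>\<^sub>E A))"

definition nontrivial_system :: "nat \<Rightarrow> 'x set \<Rightarrow> ('x set \<Rightarrow> ('x \<Rightarrow> 'a) set) \<Rightarrow> bool" where
  "nontrivial_system k X P \<longleftrightarrow> (\<forall>K\<in>subsets_le k X. P K \<noteq> {})"

definition compatible_system ::
  "('f, 'r) signature \<Rightarrow> nat \<Rightarrow> nat \<Rightarrow> ('f, 'r, 'x) struct \<Rightarrow> ('f, 'r, 'a) struct \<Rightarrow>
   ('x set \<Rightarrow> ('x \<Rightarrow> 'a) set) \<Rightarrow> bool" where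
  "compatible_system S k l X A P \<longleftrightarrow>
     kl_system k l (univ X) (univ A) P \<and>
     (\<forall>R\<in>rels (graph_signature S). \<forall>ys\<in>rel_of (graph_struct S X) R.
        forth_property k P (set ys)
          {g \<in> set ys \<rightarrow>\<^sub>E univ A. map g ys \<in> rel_of (graph_struct S A) R})"

text \<open>Instances have their domain in \<^typ>\<open>nat\<close>; as they are finite, this is no restriction
  (see \<open>relational_widthD\<close> below).\<close>

definition relational_width ::
  "('f, 'r) signature \<Rightarrow> nat \<Rightarrow> nat \<Rightarrow> ('f, 'r, 'a) struct \<Rightarrow> bool" where
  "relational_width S k l A \<longleftrightarrow>
     (\<forall>X :: ('f, 'r, nat) struct.
        is_structure S X \<and> finite (univ X) \<and>
        (\<exists>P. compatible_system S k l X A P \<and> nontrivial_system k (univ X) P) \<longrightarrow>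
        (\<exists>h. homomorphism S X A h))"

definition bounded_relational_width ::
  "('f, 'r) signature \<Rightarrow> ('f, 'r, 'a) struct \<Rightarrow> bool" where
  "bounded_relational_width S A \<longleftrightarrow> (\<exists>k l. 1 \<le> k \<and> k \<le> l \<and> relational_width S k l A)"

definition transport_system ::
  "('y \<Rightarrow> 'x) \<Rightarrow> ('x set \<Rightarrow> ('x \<Rightarrow> 'a) set) \<Rightarrow> 'y set \<Rightarrow> ('y \<Rightarrow> 'a) set" where
  "transport_system d P K = (\<lambda>f. restrict (f \<circ> d) K) ` P (d ` K)"

lemma subsets_le_image:
  assumes "K \<in> subsets_le k (e ` L)" "\<And>x. x \<in> L \<Longrightarrow> d (e x) = x"
  shows "d ` K \<in> subsets_le k L"
proof -
  have "card (d ` K) \<le> card K"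
    using assms(1) by (auto simp: subsets_le_def intro: card_image_le)
  moreover have "d ` K \<subseteq> L"
    using assms by (auto simp: subsets_le_def)
  ultimately show ?thesis
    using assms(1) by (auto simp: subsets_le_def)
qed

lemma forth_property_transport:
  assumes fp: "forth_property k P L C"
    and de: "\<And>x. x \<in> L \<Longrightarrow> d (e x) = x"
    and C: "\<And>g. g \<in> C \<Longrightarrow> restrict (g \<circ> d) (e ` L) \<in> C'"
  shows "forth_property k (transport_system d P) (e ` L) C'"
  unfolding forth_property_def
proof (intro ballI)
  fix K f' assume K: "K \<in> subsets_le k (e ` L)" and f': "f' \<in> transport_system d P K"
  then obtain f where f: "f \<in> P (d ` K)" "f' = restrict (f \<circ> d) K"
    by (auto simp: transport_system_def)
  have "d ` K \<in> subsets_le k L"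
    using K de by (rule subsets_le_image)
  then obtain g where g: "g \<in> C" "restrict g (d ` K) = f"
      "\<forall>K'\<in>subsets_le k L. restrict g K' \<in> P K'"
    using fp f unfolding forth_property_def by blast
  let ?g = "restrict (g \<circ> d) (e ` L)"
  have sub: "K' \<subseteq> e ` L" if "K' \<in> subsets_le k (e ` L)" for K'
    using that by (simp add: subsets_le_def)
  have eq: "restrict ?g K' = restrict (restrict g (d ` K') \<circ> d) K'"
    if "K' \<in> subsets_le k (e ` L)" for K'
    using sub[OF that] by (auto simp: fun_eq_iff restrict_def)
  have "restrict ?g K' \<in> transport_system d P K'" if "K' \<in> subsets_le k (e ` L)" for K'
    using g(3) subsets_le_image[OF that de] unfolding eq[OF that] transport_system_def by blast
  moreover have "restrict ?g K = f'"
    using eq[OF K] f g by simp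
  ultimately show "\<exists>g\<in>C'. restrict g K = f' \<and>
      (\<forall>K'\<in>subsets_le k (e ` L). restrict g K' \<in> transport_system d P K')"
    using C[OF g(1)] by blast
qed

lemma relational_widthD:
  fixes X :: "('f, 'r, 'x) struct" and A :: "('f, 'r, 'a) struct"
  assumes width: "relational_width S k l A"
    and X: "is_structure S X" "finite (univ X)"
    and P: "compatible_system S k l X A P" "nontrivial_system k (univ X) P"
  shows "\<exists>h. homomorphism S X A h"
proof -
  obtain e :: "'x \<Rightarrow> nat" where e: "inj_on e (univ X)"
    using finite_imp_inj_to_nat_seg[OF X(2)] by blast
  define d where "d = inv_into (univ X) e"
  have de: "d (e x) = x" if "x \<in> univ X" for x
    using that e by (simp add: d_def)
  have map_de: "map (d \<circ> e) xs = xs" if "set xs \<subseteq> univ X" for xs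
    by (rule map_idI) (use that de in auto)
  define Y :: "('f, 'r, nat) struct" where
    "Y = \<lparr>univ = e ` univ X, op_of = (\<lambda>f ys. e (op_of X f (map d ys))),
          rel_of = (\<lambda>r. map e ` rel_of X r)\<rparr>"
  have tuplesY: "tuples (e ` univ X) n = map e ` tuples (univ X) n" for n
  proof
    show "map e ` tuples (univ X) n \<subseteq> tuples (e ` univ X) n"
      by (force simp: tuples_def)
    show "tuples (e ` univ X) n \<subseteq> map e ` tuples (univ X) n"
    proof
      fix ys assume ys: "ys \<in> tuples (e ` univ X) n"
      have "e (d y) = y" "d y \<in> univ X" if "y \<in> e ` univ X" for y
        using that de by auto
      then have "map e (map d ys) = ys" "map d ys \<in> tuples (univ X) n"
        using ys by (auto simp: tuples_def subset_iff intro!: map_idI)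
      then show "ys \<in> map e ` tuples (univ X) n"
        by (metis imageI)
    qed
  qed
  have opY: "op_of Y f (map e xs) = e (op_of X f xs)" if "xs \<in> tuples (univ X) n" for f xs n
    using that map_de[of xs] by (simp add: Y_def tuples_def)
  have relY: "rel_of (graph_struct S Y) R = map e ` rel_of (graph_struct S X) R" for R
  proof (cases R)
    case (Inl r)
    then show ?thesis by (simp add: graph_struct_def Y_def)
  next
    case (Inr f)
    let ?T = "tuples (univ X) (op_arity S f)"
    have "rel_of (graph_struct S Y) R = (\<lambda>ys. ys @ [op_of Y f ys]) ` map e ` ?T"
      using Inr tuplesY by (auto simp: graph_struct_def Y_def)
    also have "\<dots> = (\<lambda>xs. map e (xs @ [op_of X f xs])) ` ?T"
      unfolding image_image by (rule image_cong) (auto simp: opY)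
    also have "\<dots> = map e ` rel_of (graph_struct S X) R"
      using Inr by (simp add: graph_struct_def Setcompr_eq_image image_image)
    finally show ?thesis .
  qed
  have subX: "set ys \<subseteq> univ X"
    if "R \<in> rels (graph_signature S)" "ys \<in> rel_of (graph_struct S X) R" for R ys
    using that X(1) unfolding is_structure_def
    by (auto simp: graph_signature_def graph_struct_def tuples_def) blast+
  have Y: "is_structure S Y" "finite (univ Y)"
  proof -
    show "finite (univ Y)" using X(2) by (simp add: Y_def)
    have "op_of Y f ys \<in> univ Y" if f: "f \<in> ops S" and ys: "ys \<in> tuples (univ Y) (op_arity S f)" for f ys
    proof -
      obtain xs where "ys = map e xs" "xs \<in> tuples (univ X) (op_arity S f)"
        using ys tuplesY by (auto simp: Y_def)
      then have "op_of Y f ys = e (op_of X f xs)" "op_of X f xs \<in> univ X"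
        using X(1) f opY by (auto simp: is_structure_def)
      then show ?thesis by (simp add: Y_def)
    qed
    moreover have "rel_of Y r \<subseteq> tuples (univ Y) (rel_arity S r)" if "r \<in> rels S" for r
      using X(1) that by (simp add: is_structure_def Y_def tuplesY image_mono)
    ultimately show "is_structure S Y" by (simp add: is_structure_def)
  qed
  let ?Q = "transport_system d P"
  have PiE: "restrict (g \<circ> d) (e ` L) \<in> (e ` L \<rightarrow>\<^sub>E univ A)"
    if "g \<in> (L \<rightarrow>\<^sub>E univ A)" "L \<subseteq> univ X" for g L
  proof (rule restrict_PiE_iff[THEN iffD2], rule ballI)
    fix y assume "y \<in> e ` L"
    then obtain x where "x \<in> L" "y = e x" by blast
    moreover from this have "d (e x) = x" using that(2) de by blast
    ultimately show "(g \<circ> d) y \<in> univ A" using that(1) by (auto dest: PiE_mem)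
  qed
  have im: "d ` K \<in> subsets_le m (univ X)" if "K \<in> subsets_le m (univ Y)" for K m
    using subsets_le_image[of K m e "univ X" d] that de by (simp add: Y_def)
  have ed: "e ` d ` K = K" if "K \<in> subsets_le m (univ Y)" for K m
  proof -
    have "e (d y) = y" if "y \<in> K" for y
      using that \<open>K \<in> subsets_le m (univ Y)\<close> de by (auto simp: Y_def subsets_le_def)
    then show ?thesis by (simp add: image_image)
  qed
  have sys: "kl_system k l (univ X) (univ A) P"
    using P(1) by (simp add: compatible_system_def)
  have "kl_system k l (univ Y) (univ A) ?Q"
    unfolding kl_system_def
  proof (intro conjI ballI)
    show "k \<le> l" using sys by (simp add: kl_system_def)
  next
    fix K assume K: "K \<in> subsets_le k (univ Y)"
    then have "P (d ` K) \<subseteq> (d ` K \<rightarrow>\<^sub>E univ A)"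
      using sys im by (simp add: kl_system_def)
    then show "?Q K \<subseteq> (K \<rightarrow>\<^sub>E univ A)"
      by (auto simp: transport_system_def restrict_PiE_iff)
        (metis PiE_mem imageI subsetD)
  next
    fix L assume L: "L \<in> subsets_le l (univ Y)"
    have sub: "d ` L \<subseteq> univ X" using im[OF L] by (simp add: subsets_le_def)
    have "forth_property k P (d ` L) (d ` L \<rightarrow>\<^sub>E univ A)"
      using sys im[OF L] by (simp add: kl_system_def)
    then have "forth_property k ?Q (e ` d ` L) (e ` d ` L \<rightarrow>\<^sub>E univ A)"
    proof (rule forth_property_transport)
      show "d (e x) = x" if "x \<in> d ` L" for x using that sub de by blast
      show "restrict (g \<circ> d) (e ` d ` L) \<in> (e ` d ` L \<rightarrow>\<^sub>E univ A)"
        if "g \<in> (d ` L \<rightarrow>\<^sub>E univ A)" for g using PiE[OF that sub] .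
    qed
    then show "forth_property k ?Q L (L \<rightarrow>\<^sub>E univ A)"
      using ed[OF L] by simp
  qed
  moreover have "forth_property k ?Q (set ys)
      {g \<in> set ys \<rightarrow>\<^sub>E univ A. map g ys \<in> rel_of (graph_struct S A) R}"
    if R: "R \<in> rels (graph_signature S)" and ys: "ys \<in> rel_of (graph_struct S Y) R" for R ys
  proof -
    obtain xs where xs: "ys = map e xs" "xs \<in> rel_of (graph_struct S X) R"
      using ys relY by auto
    have sub: "set xs \<subseteq> univ X" using subX R xs(2) .
    have map_eq: "map (restrict (g \<circ> d) (e ` set xs)) ys = map g xs" for g :: "'x \<Rightarrow> 'a"
      using sub de by (auto simp: xs(1) subset_iff)
    have "forth_property k P (set xs)
        {g \<in> set xs \<rightarrow>\<^sub>E univ A. map g xs \<in> rel_of (graph_struct S A) R}"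
      using P(1) R xs(2) by (simp add: compatible_system_def)
    then have "forth_property k ?Q (e ` set xs)
        {g \<in> e ` set xs \<rightarrow>\<^sub>E univ A. map g ys \<in> rel_of (graph_struct S A) R}"
    proof (rule forth_property_transport)
      show "d (e x) = x" if "x \<in> set xs" for x using that sub de by blast
      show "restrict (g \<circ> d) (e ` set xs)
          \<in> {g \<in> e ` set xs \<rightarrow>\<^sub>E univ A. map g ys \<in> rel_of (graph_struct S A) R}"
        if "g \<in> {g \<in> set xs \<rightarrow>\<^sub>E univ A. map g xs \<in> rel_of (graph_struct S A) R}" for g
        using that PiE[OF _ sub, of g] unfolding mem_Collect_eq map_eq by blast
    qed
    then show ?thesis by (simp add: xs(1))
  qed
  ultimately have "compatible_system S k l Y A ?Q"
    by (simp add: compatible_system_def)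
  moreover have "nontrivial_system k (univ Y) ?Q"
    using P(2) im by (simp add: nontrivial_system_def transport_system_def)
  ultimately obtain h where h: "homomorphism S Y A h"
    using width Y unfolding relational_width_def by blast
  have "homomorphism S X A (h \<circ> e)"
    unfolding homomorphism_def
  proof (intro conjI ballI)
    show "(h \<circ> e) ` univ X \<subseteq> univ A"
      using h by (auto simp: homomorphism_def Y_def)
  next
    fix f xs assume f: "f \<in> ops S" and xs: "xs \<in> tuples (univ X) (op_arity S f)"
    then have "map e xs \<in> tuples (univ Y) (op_arity S f)"
      by (auto simp: Y_def tuples_def)
    then have "h (op_of Y f (map e xs)) = op_of A f (map h (map e xs))"
      using h f by (simp add: homomorphism_def)
    then show "(h \<circ> e) (op_of X f xs) = op_of A f (map (h \<circ> e) xs)"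
      using opY[OF xs] by simp
  next
    fix r xs assume "r \<in> rels S" "xs \<in> rel_of X r"
    then have "map h (map e xs) \<in> rel_of A r"
      using h by (auto simp: homomorphism_def Y_def)
    then show "map (h \<circ> e) xs \<in> rel_of A r" by simp
  qed
  then show ?thesis by blast
qed

end

theory Submission imports Defs begin

text \<open>
  The structure is the group \<open>\<int>/2\<close> with its addition and a constant for \<open>1\<close>. Solving linear
  equations over \<open>\<int>/2\<close> is the standard source of unbounded width, but in an instance with a total
  addition every partial sum of variables is named by an element. Hence the elements forced to be
  \<open>0\<close> by a consistent system behave like a linear subspace avoiding \<open>1\<close>; it extends to a maximal
  one, a hyperplane, which is the kernel of a homomorphism. All identities needed for this involve
  at most eight elements. For \<open>(2,3)\<close>-systems the argument breaks down because commutativity of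
  addition cannot be detected: modify the sum of \<open>(\<int>/2)\<^sup>3\<close> so that \<open>a + b = c\<close> but \<open>b + a = c + 1\<close>.
\<close>

section \<open>Maximal subspaces avoiding the constant\<close>

text \<open>A hyperplane \<open>H\<close> is described by the single closure condition
  \<open>x \<in> H \<Longrightarrow> x + y \<in> H \<Longrightarrow> y \<in> H\<close>: as \<open>H\<close> contains all forced zeros, such as
  \<open>x + (y + (x + y))\<close>, closure under addition follows.\<close>

lemma parity_map_from_local_maps:
  fixes p :: "'x \<Rightarrow> 'x \<Rightarrow> 'x"
  assumes fin: "finite X" and clo: "\<And>x y. x \<in> X \<Longrightarrow> y \<in> X \<Longrightarrow> p x y \<in> X" and e: "e \<in> X"
    and ZX: "Z \<subseteq> X" and eZ: "e \<notin> Z"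
    and loc: "\<And>L t. \<lbrakk>L \<subseteq> X; finite L; card L \<le> 8; t \<in> L; t \<notin> Z\<rbrakk> \<Longrightarrow>
      \<exists>g. g t \<and> (\<forall>x\<in>L \<inter> Z. \<not> g x) \<and>
        (\<forall>x\<in>L. \<forall>y\<in>L. p x y \<in> L \<longrightarrow> g (p x y) = (g x \<noteq> g y))"
  shows "\<exists>h. h e \<and> (\<forall>x\<in>X. \<forall>y\<in>X. h (p x y) = (h x \<noteq> h y))"
proof -
  define additive_on where "additive_on g L \<longleftrightarrow>
      (\<forall>x\<in>L. \<forall>y\<in>L. p x y \<in> L \<longrightarrow> g (p x y) = (g x \<noteq> g y))" for g and L :: "'x set"
  have additive_onD: "g (p x y) = (g x \<noteq> g y)"
    if "additive_on g L" "x \<in> L" "y \<in> L" "p x y \<in> L" for g L x y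
    using that by (simp add: additive_on_def)
  \<comment> \<open>Contrapositive of \<open>loc\<close>: forced zeros are found by checking a list
    that holds all the subterms needed. The longest lists below have eight entries, whence the
    bound.\<close>
  have vanish: "t \<in> Z" if "set xs \<subseteq> X" "length xs \<le> 8" "t \<in> set xs"
    and zero: "\<And>g. additive_on g (set xs) \<Longrightarrow> \<forall>x\<in>set xs \<inter> Z. \<not> g x \<Longrightarrow> \<not> g t" for xs t
  proof (rule ccontr)
    assume "t \<notin> Z"
    have "card (set xs) \<le> 8" using card_length[of xs] that(2) by linarith
    from loc[OF that(1) _ this that(3) \<open>t \<notin> Z\<close>]
    obtain g where "g t" "\<forall>x\<in>set xs \<inter> Z. \<not> g x" "additive_on g (set xs)"
      unfolding additive_on_def by auto
    then show False using zero by blast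
  qed
  have Z_cancel: "y \<in> Z" if "x \<in> X" "y \<in> X" "x \<in> Z" "p x y \<in> Z" for x y
  proof (rule vanish[of "[x, y, p x y]"])
    fix g assume "additive_on g (set [x, y, p x y])" "\<forall>z\<in>set [x, y, p x y] \<inter> Z. \<not> g z"
    then show "\<not> g y"
      using that additive_onD[of g "set [x, y, p x y]" x y] by simp
  qed (use that clo in auto)
  have Z_xx: "p x x \<in> Z" if "x \<in> X" for x
    by (rule vanish[of "[x, p x x]"])
      (use that clo in \<open>auto simp: additive_onD\<close>)
  have Z_add: "p x (p y (p x y)) \<in> Z" if "x \<in> X" "y \<in> X" for x y
    by (rule vanish[of "[x, y, p x y, p y (p x y), p x (p y (p x y))]"])
      (use that clo in \<open>auto simp: additive_onD\<close>)
  have Z_comm: "p (p x y) (p y x) \<in> Z" if "x \<in> X" "y \<in> X" for x y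
    by (rule vanish[of "[x, y, p x y, p y x, p (p x y) (p y x)]"])
      (use that clo in \<open>auto simp: additive_onD\<close>)
  have Z_left_comm: "p (p x (p y z)) (p y (p x z)) \<in> Z" if "x \<in> X" "y \<in> X" "z \<in> X" for x y z
    by (rule vanish[of "[x, y, z, p y z, p x (p y z), p x z, p y (p x z),
        p (p x (p y z)) (p y (p x z))]"])
      (use that clo in \<open>auto simp: additive_onD\<close>)
  have Z_triangle: "p (p x y) (p (p y z) (p x z)) \<in> Z" if "x \<in> X" "y \<in> X" "z \<in> X" for x y z
    by (rule vanish[of "[x, y, z, p x y, p y z, p x z, p (p y z) (p x z),
        p (p x y) (p (p y z) (p x z))]"])
      (use that clo in \<open>auto simp: additive_onD\<close>)
  have Z_triangle': "p (p x z) (p (p y z) (p x y)) \<in> Z" if "x \<in> X" "y \<in> X" "z \<in> X" for x y z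
    by (rule vanish[of "[x, y, z, p x y, p y z, p x z, p (p y z) (p x y),
        p (p x z) (p (p y z) (p x y))]"])
      (use that clo in \<open>auto simp: additive_onD\<close>)
  have Z_assoc: "p (p x y) (p (p x (p y z)) z) \<in> Z" if "x \<in> X" "y \<in> X" "z \<in> X" for x y z
    by (rule vanish[of "[x, y, z, p x y, p y z, p x (p y z), p (p x (p y z)) z,
        p (p x y) (p (p x (p y z)) z)]"])
      (use that clo in \<open>auto simp: additive_onD\<close>)
  define good where "good H \<longleftrightarrow> Z \<subseteq> H \<and> e \<notin> H \<and> (\<forall>x\<in>X. \<forall>y\<in>X. x \<in> H \<longrightarrow> p x y \<in> H \<longrightarrow> y \<in> H)"
    for H
  have "finite {H \<in> Pow X. good H}" using fin by simp
  moreover have "Z \<in> {H \<in> Pow X. good H}" using ZX eZ Z_cancel by (simp add: good_def)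
  then have "{H \<in> Pow X. good H} \<noteq> {}" by blast
  ultimately have "\<exists>H\<in>{H \<in> Pow X. good H}. \<forall>H'\<in>{H \<in> Pow X. good H}. H \<subseteq> H' \<longrightarrow> H = H'"
    by (rule finite_has_maximal)
  then obtain H where "H \<in> {H \<in> Pow X. good H}"
    "\<forall>H'\<in>{H \<in> Pow X. good H}. H \<subseteq> H' \<longrightarrow> H = H'"
    by (rule bexE)
  then have H: "H \<subseteq> X" "good H"
    and maximal: "\<And>H'. H' \<subseteq> X \<Longrightarrow> good H' \<Longrightarrow> H \<subseteq> H' \<Longrightarrow> H' = H"
    by auto
  have ZH: "Z \<subseteq> H" and eH: "e \<notin> H"
    using H(2) by (auto simp only: good_def)
  note cancel = H(2)[unfolded good_def, THEN conjunct2, THEN conjunct2, rule_format]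
  \<comment> \<open>Cancelling twice. From \<open>Z_add\<close> on, the identities all have the
    shape \<open>p u (p v w)\<close>, so that each becomes a rule: if \<open>u\<close> and
    \<open>v\<close> lie in \<open>H\<close>, so does \<open>w\<close>.\<close>
  have cancel2: "z \<in> H"
    if "x \<in> H" "y \<in> H" "z \<in> X" "p x (p y z) \<in> Z" for x y z
  proof -
    have "x \<in> X" "y \<in> X" "p x (p y z) \<in> H" using that H(1) ZH by auto
    then show ?thesis using that clo cancel[of x "p y z"] cancel[of y z] by simp
  qed
  have add: "p x y \<in> H" if "x \<in> H" "y \<in> H" for x y
  proof -
    have "x \<in> X" "y \<in> X" using that H(1) by auto
    then show ?thesis using that cancel2[of x y "p x y"] Z_add[of x y] clo by simp
  qed
  have complement: "p x e \<in> H" if x: "x \<in> X" "x \<notin> H" for x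
  proof -
    \<comment> \<open>\<open>H'\<close> plays the span of \<open>H\<close> and \<open>x\<close>. It
      inherits every condition of \<open>good\<close> except possibly the avoidance of
      \<open>e\<close>, so maximality of \<open>H\<close> puts \<open>e\<close> into it.\<close>
    define H' where "H' = {y \<in> X. y \<in> H \<or> p x y \<in> H}"
    have "x \<in> H'" using Z_xx x ZH by (auto simp: H'_def)
    then have "H' \<noteq> H" using x by blast
    have "H' \<subseteq> X" "H \<subseteq> H'" using H(1) by (auto simp: H'_def)
    with \<open>H' \<noteq> H\<close> have "\<not> good H'" using maximal by blast
    moreover have "Z \<subseteq> H'" using ZH \<open>H \<subseteq> H'\<close> by (rule subset_trans)
    moreover have "\<forall>y\<in>X. \<forall>z\<in>X. y \<in> H' \<longrightarrow> p y z \<in> H' \<longrightarrow> z \<in> H'"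
    proof (intro ballI impI)
      fix y z assume yz: "y \<in> X" "z \<in> X" and "y \<in> H'" "p y z \<in> H'"
      \<comment> \<open>Each of \<open>y\<close> and \<open>p y z\<close> lies in \<open>H\<close>
        or in the coset of \<open>x\<close>. If both lie in the same one, then \<open>z\<close> is
        in \<open>H\<close>; otherwise \<open>p x z\<close> is.\<close>
      consider "y \<in> H" "p y z \<in> H" | "y \<in> H" "p x (p y z) \<in> H"
        | "p x y \<in> H" "p y z \<in> H" | "p x y \<in> H" "p x (p y z) \<in> H"
        using \<open>y \<in> H'\<close> \<open>p y z \<in> H'\<close> by (auto simp: H'_def)
      then have "z \<in> H \<or> p x z \<in> H"
      proof cases
        case 1 then show ?thesis using cancel[of y z] yz by simp
      next
        case 2 then show ?thesis
          using cancel2[of "p x (p y z)" y "p x z"] Z_left_comm x yz clo by simp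
      next
        case 3 then show ?thesis
          using cancel2[of "p x y" "p y z" "p x z"] Z_triangle x yz clo by simp
      next
        case 4 then show ?thesis
          using cancel2[of "p x y" "p x (p y z)" z] Z_assoc x yz by simp
      qed
      then show "z \<in> H'" using yz by (simp add: H'_def)
    qed
    ultimately have "e \<in> H'" unfolding good_def by argo
    then show ?thesis using eH by (simp add: H'_def)
  qed
  have "p x y \<notin> H \<longleftrightarrow> (x \<notin> H \<longleftrightarrow> y \<in> H)" if xy: "x \<in> X" "y \<in> X" for x y
  proof (cases "x \<in> H"; cases "y \<in> H")
    assume "x \<in> H" "y \<in> H"
    then show ?thesis using add by blast
  next
    assume "x \<in> H" "y \<notin> H"
    then show ?thesis using cancel[of x y] xy by blast
  next
    \<comment> \<open>\<open>cancel\<close> removes only a left summand. Here the right one must go,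
      and \<open>p\<close> is commutative only modulo \<open>Z\<close>.\<close>
    assume *: "x \<notin> H" "y \<in> H"
    have "p x y \<notin> H"
    proof
      assume "p x y \<in> H"
      then show False using cancel2[of "p x y" y x] Z_comm xy * by simp
    qed
    then show ?thesis using * by blast
  next
    \<comment> \<open>By \<open>complement\<close>, both \<open>x\<close> and \<open>y\<close> lie
      in the coset of \<open>e\<close>, so their sum falls into \<open>H\<close>.\<close>
    assume *: "x \<notin> H" "y \<notin> H"
    then show ?thesis
      using cancel2[of "p x e" "p y e" "p x y"] Z_triangle'[of x y e] complement xy clo e by simp
  qed
  then show ?thesis
    using eH by (intro exI[of _ "\<lambda>x. x \<notin> H"]) auto
qed

section \<open>The two-element group with a constant, and systems over it\<close>

text \<open>Symbol \<open>0\<close> is addition and symbol \<open>1\<close> the constant. Without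
  relation symbols, an instance is constrained only by the graphs of these two operations.\<close>

definition parity_sig :: "(nat, nat) signature" where
  "parity_sig = \<lparr>ops = {0, 1}, rels = {}, op_arity = (\<lambda>f. if f = 0 then 2 else 0),
     rel_arity = (\<lambda>_. 0)\<rparr>"

definition parity_struct :: "(nat, nat, nat) struct" where
  "parity_struct = \<lparr>univ = {0, 1}, op_of = (\<lambda>f xs. if f = 0 then sum_list xs mod 2 else 1),
     rel_of = (\<lambda>_. {})\<rparr>"

lemma tuples_0: "tuples A 0 = {[]}"
  by (auto simp: tuples_def)

lemma tuples_2: "tuples A 2 = {[x, y] |x y. x \<in> A \<and> y \<in> A}"
  by (auto simp: tuples_def numeral_2_eq_2 length_Suc_conv)

lemma is_structure_parity:
  "is_structure parity_sig X \<longleftrightarrow>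
     (\<forall>x\<in>univ X. \<forall>y\<in>univ X. op_of X 0 [x, y] \<in> univ X) \<and> op_of X 1 [] \<in> univ X"
  by (auto simp: is_structure_def parity_sig_def tuples_0 tuples_2)

lemma homomorphism_parity:
  "homomorphism parity_sig X parity_struct h \<longleftrightarrow>
     h ` univ X \<subseteq> {0, 1} \<and> h (op_of X 1 []) = 1 \<and>
     (\<forall>x\<in>univ X. \<forall>y\<in>univ X. h (op_of X 0 [x, y]) = (h x + h y) mod 2)"
  by (auto simp: homomorphism_def parity_sig_def parity_struct_def tuples_0 tuples_2)

text \<open>Tuples and graphs are eliminated here once, for both the positive result and the
  counterexample.\<close>

lemma compatible_system_parity:
  fixes X :: "(nat, nat, 'x) struct"
  shows "compatible_system parity_sig k l X parity_struct P \<longleftrightarrow>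
     kl_system k l (univ X) {0, 1} P \<and>
     forth_property k P {op_of X 1 []} {g \<in> {op_of X 1 []} \<rightarrow>\<^sub>E {0, 1}. g (op_of X 1 []) = 1} \<and>
     (\<forall>x\<in>univ X. \<forall>y\<in>univ X.
        forth_property k P {x, y, op_of X 0 [x, y]}
          {g \<in> {x, y, op_of X 0 [x, y]} \<rightarrow>\<^sub>E {0, 1}. g (op_of X 0 [x, y]) = (g x + g y) mod 2})"
proof -
  have A: "univ parity_struct = {0, 1}" by (simp add: parity_struct_def)
  have R: "rels (graph_signature parity_sig) = {Inr 0, Inr 1}"
    by (auto simp: graph_signature_def parity_sig_def)
  have R0: "rel_of (graph_struct parity_sig Y) (Inr 0) =
      {[x, y, op_of Y 0 [x, y]] |x y. x \<in> univ Y \<and> y \<in> univ Y}" for Y :: "(nat, nat, 'y) struct"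
    by (force simp: graph_struct_def parity_sig_def tuples_2)
  have R1: "rel_of (graph_struct parity_sig Y) (Inr 1) = {[op_of Y 1 []]}"
    for Y :: "(nat, nat, 'y) struct"
    by (auto simp: graph_struct_def parity_sig_def tuples_0)
  have ball_R0: "(\<forall>ys\<in>{[x, y, op_of X 0 [x, y]] |x y. x \<in> univ X \<and> y \<in> univ X}. Q ys) \<longleftrightarrow>
      (\<forall>x\<in>univ X. \<forall>y\<in>univ X. Q [x, y, op_of X 0 [x, y]])" for Q
    by blast
  have eq0: "{g \<in> set [x, y, z] \<rightarrow>\<^sub>E {0, 1}.
        map g [x, y, z] \<in> rel_of (graph_struct parity_sig parity_struct) (Inr 0)} =
      {g \<in> {x, y, z} \<rightarrow>\<^sub>E {0, 1}. g z = (g x + g y) mod 2}" for x y z :: 'x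
    unfolding R0 A by (auto simp: parity_struct_def)
  have eq1: "{g \<in> set [x] \<rightarrow>\<^sub>E {0, 1}.
        map g [x] \<in> rel_of (graph_struct parity_sig parity_struct) (Inr 1)} =
      {g \<in> {x} \<rightarrow>\<^sub>E {0, 1}. g x = 1}" for x :: 'x
    unfolding R1 A by (auto simp: parity_struct_def)
  show ?thesis
    unfolding compatible_system_def R A R0[of X] R1[of X] ball_R0
      ball_simps(5,7) eq0 eq1
    unfolding list.set by argo
qed

section \<open>Relational width (8,8)\<close>

text \<open>A scope of size at most \<open>k\<close> may itself serve as \<open>K\<close>, so a
  local map in the system agrees on all of \<open>L\<close> with a member of \<open>C\<close>. For
  \<open>k = 2\<close> this fails to cover sums of three distinct elements.\<close>

lemma forth_property_full:
  assumes "forth_property k P L C" "finite L" "card L \<le> k" "restrict g L \<in> P L"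
  shows "\<exists>g'\<in>C. \<forall>x\<in>L. g' x = g x"
proof -
  have "L \<in> subsets_le k L" using assms by (simp add: subsets_le_def)
  then obtain g' where "g' \<in> C" "restrict g' L = restrict g L"
    using assms unfolding forth_property_def by blast
  then show ?thesis by (metis restrict_apply')
qed

text \<open>With \<open>Z\<close> the set of elements that the system forces to \<open>0\<close>,
  the system supplies the local maps required by \<open>parity_map_from_local_maps\<close>; the
  resulting global map, read as 0 and 1, is the homomorphism.\<close>

lemma parity_struct_width_8: "relational_width parity_sig 8 8 parity_struct"
  unfolding relational_width_def
proof (intro allI impI, elim conjE exE)
  fix X :: "(nat, nat, nat) struct" and P
  assume str: "is_structure parity_sig X" and fin: "finite (univ X)"
    and com: "compatible_system parity_sig 8 8 X parity_struct P"
    and nontriv: "nontrivial_system 8 (univ X) P"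
  define p where "p x y = op_of X 0 [x, y]" for x y
  define e where "e = op_of X 1 []"
  define Z where "Z = {x \<in> univ X. \<forall>f\<in>P {x}. f x = 0}"
  have clo: "\<And>x y. x \<in> univ X \<Longrightarrow> y \<in> univ X \<Longrightarrow> p x y \<in> univ X" and e: "e \<in> univ X"
    using str by (auto simp: is_structure_parity p_def e_def)
  have forth_sum: "forth_property 8 P {x, y, p x y}
      {g \<in> {x, y, p x y} \<rightarrow>\<^sub>E {0, 1}. g (p x y) = (g x + g y) mod 2}"
    if "x \<in> univ X" "y \<in> univ X" for x y
    using com that by (simp add: compatible_system_parity p_def)
  have forth_e: "forth_property 8 P {e} {g \<in> {e} \<rightarrow>\<^sub>E {0, 1}. g e = 1}"
    using com by (simp add: compatible_system_parity e_def)
  have sys: "kl_system 8 8 (univ X) {0, 1} P"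
    using com by (simp add: compatible_system_parity)
  have sub1: "{x} \<in> subsets_le 8 (univ X)" if "x \<in> univ X" for x
    using that by (simp add: subsets_le_def)
  have "e \<notin> Z"
  \<comment> \<open>A local map at \<open>e\<close> exists by non-triviality, and the constraint for
    the constant makes its value \<open>1\<close>.\<close>
  proof
    assume "e \<in> Z"
    obtain f where f: "f \<in> P {e}"
      using nontriv sub1[OF e] by (auto simp: nontrivial_system_def)
    moreover have "P {e} \<subseteq> {e} \<rightarrow>\<^sub>E {0, 1}"
      using sys sub1[OF e] by (simp add: kl_system_def)
    ultimately have "restrict f {e} \<in> P {e}"
      by (metis PiE_restrict subsetD)
    then obtain g where "g e = 1" "g e = f e"
      using forth_property_full[OF forth_e] by force
    then show False using \<open>e \<in> Z\<close> f by (auto simp: Z_def)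
  qed
  have local_map: "\<exists>g. g t \<and> (\<forall>x\<in>L \<inter> Z. \<not> g x) \<and>
        (\<forall>x\<in>L. \<forall>y\<in>L. p x y \<in> L \<longrightarrow> g (p x y) = (g x \<noteq> g y))"
    if L: "L \<subseteq> univ X" "finite L" "card L \<le> 8" and t: "t \<in> L" "t \<notin> Z" for L t
  proof -
    obtain f where f: "f \<in> P {t}" "f t \<noteq> 0"
      using t L(1) by (auto simp: Z_def)
    \<comment> \<open>Extend a nonzero value at \<open>t\<close> to all of \<open>L\<close>.
      Restricting to singletons shows vanishing on \<open>Z\<close>; restricting to
      \<open>{x, y, p x y}\<close> shows additivity.\<close>
    have forth: "forth_property 8 P L (L \<rightarrow>\<^sub>E {0, 1})"
      using sys L by (simp add: kl_system_def subsets_le_def)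
    have "{t} \<in> subsets_le 8 L"
      using t by (simp add: subsets_le_def)
    from forth[unfolded forth_property_def, rule_format, OF this f(1)] obtain g where g: "g \<in> L \<rightarrow>\<^sub>E {0, 1}" "restrict g {t} = f"
        "\<And>K. K \<in> subsets_le 8 L \<Longrightarrow> restrict g K \<in> P K"
      by (elim bexE conjE) blast
    have range: "g x = 0 \<or> g x = 1" if "x \<in> L" for x
      using PiE_mem[OF g(1) that] by simp
    have "g t \<noteq> 0" using g(2) f(2) by auto
    moreover have "g x = 0" if "x \<in> L \<inter> Z" for x
    proof -
      have "restrict g {x} \<in> P {x}"
        by (rule g(3)) (use that in \<open>simp add: subsets_le_def\<close>)
      then have "restrict g {x} x = 0"
        using that unfolding Z_def by blast
      then show ?thesis by simp
    qed
    moreover have "(g (p x y) \<noteq> 0) = ((g x \<noteq> 0) \<noteq> (g y \<noteq> 0))" if "x \<in> L" "y \<in> L" "p x y \<in> L" for x y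
    proof -
      let ?K = "{x, y, p x y}"
      have card: "card ?K \<le> 8" by (simp add: card_insert_if)
      have "restrict g ?K \<in> P ?K"
        by (rule g(3)) (use that card in \<open>simp add: subsets_le_def\<close>)
      moreover have "x \<in> univ X" "y \<in> univ X" using that L(1) by auto
      ultimately obtain g' where "g' (p x y) = (g' x + g' y) mod 2" "\<forall>z\<in>?K. g' z = g z"
        using forth_property_full[OF forth_sum[of x y] _ card, of g] by auto
      then have "g (p x y) = (g x + g y) mod 2" by simp
      then show ?thesis using range[of x] range[of y] that by auto
    qed
    ultimately show ?thesis
      by (intro exI[of _ "\<lambda>x. g x \<noteq> 0"] conjI ballI impI) simp_all
  qed
  have "Z \<subseteq> univ X" by (auto simp: Z_def)
  from parity_map_from_local_maps[OF fin clo e this \<open>e \<notin> Z\<close> local_map] obtain h where h: "h e" "\<And>x y. x \<in> univ X \<Longrightarrow> y \<in> univ X \<Longrightarrow> h (p x y) = (h x \<noteq> h y)"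
    by blast
  then have "homomorphism parity_sig X parity_struct (\<lambda>x. of_bool (h x))"
    by (auto simp: homomorphism_parity p_def e_def)
  then show "\<exists>h. homomorphism parity_sig X parity_struct h" by blast
qed

section \<open>The twisted instance and the failure of width (2,3)\<close>

text \<open>The instance is \<open>\<int>/2 \<times> (\<int>/2)\<^sup>2\<close> with its sum corrected by \<open>twist\<close>, which is not symmetric.\<close>

definition xor2 :: "bool \<times> bool \<Rightarrow> bool \<times> bool \<Rightarrow> bool \<times> bool" where
  "xor2 u v = (fst u \<noteq> fst v, snd u \<noteq> snd v)"

definition twist :: "bool \<times> bool \<Rightarrow> bool \<times> bool \<Rightarrow> bool" where
  "twist u v \<longleftrightarrow> u = (True, False) \<and> v = (False, True)"

fun twisted_sum :: "bool \<times> bool \<times> bool \<Rightarrow> bool \<times> bool \<times> bool \<Rightarrow> bool \<times> bool \<times> bool" where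
  "twisted_sum (s, u) (t, v) = ((s \<noteq> t) \<noteq> twist u v, xor2 u v)"

definition twisted_struct :: "(nat, nat, bool \<times> bool \<times> bool) struct" where
  "twisted_struct = \<lparr>univ = UNIV,
     op_of = (\<lambda>f xs. if f = 0 then twisted_sum (xs ! 0) (xs ! 1) else (True, False, False)),
     rel_of = (\<lambda>_. {})\<rparr>"

text \<open>Modulo 2 this is \<open>s + \<phi> u\<close> at \<open>(s, u)\<close>:
  \<open>\<phi>\<close> chooses the value at \<open>(False, u)\<close>, and adding the constant
  flips it. Any homomorphism would have this form.\<close>

definition fibre_map :: "(bool \<times> bool \<Rightarrow> bool) \<Rightarrow> bool \<times> bool \<times> bool \<Rightarrow> nat" where
  "fibre_map \<phi> x = of_bool (fst x \<noteq> \<phi> (snd x))"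

text \<open>The condition on \<open>\<phi>\<close> sends zero to \<open>0\<close> and the constant
  to \<open>1\<close>; additivity is not imposed.\<close>

definition fibre_system :: "(bool \<times> bool \<times> bool) set \<Rightarrow> (bool \<times> bool \<times> bool \<Rightarrow> nat) set" where
  "fibre_system K = {restrict (fibre_map \<phi>) K |\<phi>. \<not> \<phi> (False, False)}"

text \<open>Members are restrictions of global maps, so restricting again stays in the system. It
  remains to choose \<open>\<psi>\<close> without changing the fibres that \<open>K\<close>
  meets.\<close>

lemma fibre_system_forth:
  assumes "\<And>K \<phi>. \<lbrakk>K \<in> subsets_le k L; \<not> \<phi> (False, False)\<rbrakk> \<Longrightarrow>
    \<exists>\<psi>. \<not> \<psi> (False, False) \<and> (\<forall>x\<in>K. \<psi> (snd x) = \<phi> (snd x)) \<and> restrict (fibre_map \<psi>) L \<in> C"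
  shows "forth_property k fibre_system L C"
  unfolding forth_property_def
proof (intro ballI)
  fix K f assume K: "K \<in> subsets_le k L" and "f \<in> fibre_system K"
  then obtain \<phi> where \<phi>: "\<not> \<phi> (False, False)" "f = restrict (fibre_map \<phi>) K"
    by (auto simp: fibre_system_def)
  obtain \<psi> where \<psi>: "\<not> \<psi> (False, False)" "\<forall>x\<in>K. \<psi> (snd x) = \<phi> (snd x)"
      "restrict (fibre_map \<psi>) L \<in> C"
    using assms[of K \<phi>] K \<phi>(1) by blast
  have eq: "restrict (restrict (fibre_map \<psi>) L) K' = restrict (fibre_map \<psi>) K'"
    if "K' \<in> subsets_le k L" for K'
    using that by (simp add: subsets_le_def Int_absorb1)
  have "restrict (fibre_map \<psi>) K = f"
    unfolding \<phi>(2) using \<psi>(2) by (intro restrict_ext) (simp add: fibre_map_def)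
  then show "\<exists>g\<in>C. restrict g K = f \<and> (\<forall>K'\<in>subsets_le k L. restrict g K' \<in> fibre_system K')"
    using \<psi>(1,3) eq K by (intro bexI[of _ "restrict (fibre_map \<psi>) L"]) (auto simp: fibre_system_def)
qed

text \<open>For distinct nonzero \<open>u\<close>, \<open>v\<close> the three fibres over \<open>u\<close>, \<open>v\<close>, \<open>u + v\<close> are distinct, so a
  set of two elements leaves one of the three values free to be adjusted.\<close>

lemma adjust_fibre:
  assumes K: "finite K" "card K \<le> 2" and \<phi>: "\<not> \<phi> (False, False)"
  shows "\<exists>\<psi>. \<not> \<psi> (False, False) \<and> (\<forall>x\<in>K. \<psi> (snd x) = \<phi> (snd x)) \<and>
    (\<psi> (xor2 u v) \<noteq> twist u v) = (\<psi> u \<noteq> \<psi> v)"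
proof (cases "u = v \<or> u = (False, False) \<or> v = (False, False)")
  \<comment> \<open>In these degenerate cases \<open>twist u v\<close> is false and the equation
    holds for \<open>\<phi>\<close> itself.\<close>
  case True
  then have "(\<phi> (xor2 u v) \<noteq> twist u v) = (\<phi> u \<noteq> \<phi> v)"
    using \<phi> by (cases u; cases v) (auto simp: xor2_def twist_def)
  then show ?thesis using \<phi> by blast
next
  case False
  let ?w = "xor2 u v"
  have distinct: "u \<noteq> v" "?w \<noteq> u" "?w \<noteq> v" "?w \<noteq> (False, False)"
    using False by (cases u; cases v; auto simp: xor2_def)+
  have "\<not> {u, v, ?w} \<subseteq> snd ` K"
  proof
    assume "{u, v, ?w} \<subseteq> snd ` K"
    then have "card {u, v, ?w} \<le> card (snd ` K)" using K by (intro card_mono) auto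
    also have "\<dots> \<le> 2" using card_image_le[OF K(1), of snd] K(2) by linarith
    finally show False using distinct by auto
  qed
  then consider "u \<notin> snd ` K" | "v \<notin> snd ` K" | "?w \<notin> snd ` K" by blast
  then show ?thesis
  proof cases
    \<comment> \<open>Each update solves the equation for the value on the free fibre, which is not
      the one over zero.\<close>
    case 1
    then show ?thesis using distinct False \<phi>
      by (intro exI[of _ "\<phi>(u := (\<phi> ?w \<noteq> twist u v) \<noteq> \<phi> v)"]) (auto simp: image_iff)
  next
    case 2
    then show ?thesis using distinct False \<phi>
      by (intro exI[of _ "\<phi>(v := (\<phi> ?w \<noteq> twist u v) \<noteq> \<phi> u)"]) (auto simp: image_iff)
  next
    case 3
    then show ?thesis using distinct False \<phi>
      by (intro exI[of _ "\<phi>(?w := (\<phi> u \<noteq> \<phi> v) \<noteq> twist u v)"]) (auto simp: image_iff)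
  qed
qed

lemma fibre_map_in: "restrict (fibre_map \<phi>) K \<in> K \<rightarrow>\<^sub>E {0, 1}"
  by (simp add: restrict_PiE_iff fibre_map_def of_bool_def)

text \<open>For arbitrary \<open>L\<close> and for the constant, \<open>\<phi>\<close> itself serves
  as \<open>\<psi>\<close>. Only sums need a correction, which \<open>adjust_fibre\<close> supplies
  because \<open>K\<close> has at most two elements.\<close>

lemma fibre_system_compatible:
  "compatible_system parity_sig 2 3 twisted_struct parity_struct fibre_system"
  unfolding compatible_system_parity
proof (intro conjI ballI)
  show "kl_system 2 3 (univ twisted_struct) {0, 1} fibre_system"
    unfolding kl_system_def
  proof (intro conjI ballI)
    show "fibre_system K \<subseteq> K \<rightarrow>\<^sub>E {0, 1}" for K
    proof
      fix f assume "f \<in> fibre_system K"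
      then obtain \<phi> where "f = restrict (fibre_map \<phi>) K" by (auto simp: fibre_system_def)
      then show "f \<in> K \<rightarrow>\<^sub>E {0, 1}" by (simp only: fibre_map_in)
    qed
    show "forth_property 2 fibre_system L (L \<rightarrow>\<^sub>E {0, 1})" for L
    proof (rule fibre_system_forth)
      fix K :: "(bool \<times> bool \<times> bool) set" and \<phi> :: "bool \<times> bool \<Rightarrow> bool" assume "\<not> \<phi> (False, False)"
      then show "\<exists>\<psi>. \<not> \<psi> (False, False) \<and> (\<forall>x\<in>K. \<psi> (snd x) = \<phi> (snd x)) \<and>
          restrict (fibre_map \<psi>) L \<in> L \<rightarrow>\<^sub>E {0, 1}"
        by (intro exI[of _ \<phi>] conjI ballI refl fibre_map_in)
    qed
  qed simp
next
  show "forth_property 2 fibre_system {op_of twisted_struct 1 []}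
      {g \<in> {op_of twisted_struct 1 []} \<rightarrow>\<^sub>E {0, 1}. g (op_of twisted_struct 1 []) = 1}"
  proof (rule fibre_system_forth)
    fix K :: "(bool \<times> bool \<times> bool) set" and \<phi> :: "bool \<times> bool \<Rightarrow> bool" assume "\<not> \<phi> (False, False)"
    then show "\<exists>\<psi>. \<not> \<psi> (False, False) \<and> (\<forall>x\<in>K. \<psi> (snd x) = \<phi> (snd x)) \<and>
        restrict (fibre_map \<psi>) {op_of twisted_struct 1 []} \<in>
          {g \<in> {op_of twisted_struct 1 []} \<rightarrow>\<^sub>E {0, 1}. g (op_of twisted_struct 1 []) = 1}"
      by (intro exI[of _ \<phi>]) (auto simp: twisted_struct_def fibre_map_def)
  qed
next
  fix x y :: "bool \<times> bool \<times> bool"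
  let ?z = "op_of twisted_struct 0 [x, y]"
  have z: "?z = twisted_sum x y" by (simp add: twisted_struct_def)
  show "forth_property 2 fibre_system {x, y, ?z}
      {g \<in> {x, y, ?z} \<rightarrow>\<^sub>E {0, 1}. g ?z = (g x + g y) mod 2}"
  proof (rule fibre_system_forth)
    fix K \<phi> assume "K \<in> subsets_le 2 {x, y, ?z}" and "\<not> \<phi> (False, False)"
    then have "finite K" "card K \<le> 2" by (simp_all add: subsets_le_def)
    from adjust_fibre[OF this, of \<phi> "snd x" "snd y"] \<open>\<not> \<phi> (False, False)\<close>
    obtain \<psi> where \<psi>: "\<not> \<psi> (False, False)" "\<forall>x\<in>K. \<psi> (snd x) = \<phi> (snd x)"
        "(\<psi> (xor2 (snd x) (snd y)) \<noteq> twist (snd x) (snd y)) = (\<psi> (snd x) \<noteq> \<psi> (snd y))"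
      by blast
    have "fibre_map \<psi> ?z = (fibre_map \<psi> x + fibre_map \<psi> y) mod 2"
      unfolding z using \<psi>(3)
      by (cases x; cases y) (auto simp: fibre_map_def of_bool_def split: if_splits)
    then show "\<exists>\<psi>. \<not> \<psi> (False, False) \<and> (\<forall>x\<in>K. \<psi> (snd x) = \<phi> (snd x)) \<and>
        restrict (fibre_map \<psi>) {x, y, ?z} \<in>
          {g \<in> {x, y, ?z} \<rightarrow>\<^sub>E {0, 1}. g ?z = (g x + g y) mod 2}"
      using \<psi>(1,2) fibre_map_in[of \<psi> "{x, y, ?z}"] by (intro exI[of _ \<psi>]) simp
  qed
qed

text \<open>The two sums of \<open>?a\<close> and \<open>?b\<close> must have equal images, yet they
  differ by the constant, whose image is \<open>1\<close>.\<close>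

lemma not_homomorphism_twisted: "\<not> homomorphism parity_sig twisted_struct parity_struct h"
proof
  assume "homomorphism parity_sig twisted_struct parity_struct h"
  then have one: "h (True, False, False) = 1"
    and sum: "\<And>x y. h (twisted_sum x y) = (h x + h y) mod 2"
    by (auto simp: homomorphism_parity twisted_struct_def)
  let ?a = "(False, True, False)" and ?b = "(False, False, True)"
  have "h (True, True, True) = (h ?a + h ?b) mod 2" "h (False, True, True) = (h ?b + h ?a) mod 2"
    "h (True, True, True) = (h (False, True, True) + h (True, False, False)) mod 2"
    using sum[of ?a ?b] sum[of ?b ?a] sum[of "(False, True, True)" "(True, False, False)"]
    by (simp_all add: twist_def xor2_def)
  then show False using one by presburger
qed

lemma parity_struct_not_width_2_3: "\<not> relational_width parity_sig 2 3 parity_struct"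
proof
  assume "relational_width parity_sig 2 3 parity_struct"
  moreover have "is_structure parity_sig twisted_struct" "finite (univ twisted_struct)"
    by (auto simp: is_structure_parity twisted_struct_def)
  moreover have "nontrivial_system 2 (univ twisted_struct) fibre_system"
    by (auto simp: nontrivial_system_def fibre_system_def)
  ultimately show False
    \<comment> \<open>The twisted instance consists of triples of booleans;
      \<open>relational_widthD\<close> covers instances outside the natural numbers.\<close>
    using relational_widthD fibre_system_compatible not_homomorphism_twisted by blast
qed

theorem theorem5:
  "\<exists>(S :: (nat, nat) signature) (A :: (nat, nat, nat) struct).
     finite_signature S \<and> is_structure S A \<and> finite (univ A) \<and>
     bounded_relational_width S A \<and> \<not> relational_width S 2 3 A"
proof (intro exI conjI)
  show "finite_signature parity_sig"
    by (simp add: finite_signature_def parity_sig_def)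
  show "is_structure parity_sig parity_struct" "finite (univ parity_struct)"
    by (auto simp: is_structure_parity parity_struct_def)
  show "bounded_relational_width parity_sig parity_struct"
    unfolding bounded_relational_width_def
    using parity_struct_width_8 by (intro exI[of _ 8]) simp
  show "\<not> relational_width parity_sig 2 3 parity_struct"
    by (rule parity_struct_not_width_2_3)
qed

end
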